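(* Let $M\ge1$, $i\in\{1,\dots,M\}$, and for $m\in\{1,\dots,M\}$ let $w_i^{(m)}\in\mathbb{R}^{d/M}$ (the $i$-th segment of the vector of worker $m$). Let $$X=\frac1M Q_s\left(\dots Q_s\left(Q_s\left(w_i^{(1)}\right)+w_i^{(2)}\right)+\dots+w_i^{(M)}\right).$$ Then $$\mathbb{E}\left\|X-\frac1M\sum_{m=1}^Mw_i^{(m)}\right\|_2^2\le\frac{2C_1}{M}\sum_{m=1}^M\left\|w_i^{(m)}\right\|_2^2,$$ where $$C_1:=\frac1M\exp\left(\frac{d}{4s^2}\right)+\frac{4s^2}{d}\left(\frac{d}{4s^2M}+1\right)^{M-1}-\left(\frac{4s^2}{d}+1\right).$$
   Context: Here $d$ is a positive integer divisible by $M$ and $s\ge1$ is an integer. For a nonzero vector $v$, $Q_s(v)$ is the random vector with independent coordinates $Q_s(v)_i=\|v\|_2\,\mathrm{sgn}(v_i)\,\zeta(v_i,s)/s$, where, with $\ell\in\{0,\dots,s-1\}$ an integer such that $|v_i|/\|v\|_2\in[\ell/s,(\ell+1)/s]$, $\zeta(v_i,s)=\ell+1$ with probability $\frac{|v_i|}{\|v\|_2}s-\ell$ and $\zeta(v_i,s)=\ell$ otherwise; $Q_s(0)=0$. Successive applications of $Q_s$ use independent randomness, and all applications here act on $\mathbb{R}^{d/M}$. The expectation is over the quantization randomness. *)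

theory Defs
  imports "HOL-Probability.Probability" "HOL-Probability.Product_PMF"
begin

text \<open>If \<open>r\<close> is an interior grid point \<open>k/s\<close>, both \<open>k - 1\<close> and \<open>k\<close> are admissible levels; either choice
  gives the same law for \<open>zeta_pmf\<close> below (the point mass at \<open>k\<close>).\<close>

definition quant_level :: "nat \<Rightarrow> real \<Rightarrow> nat" where
  "quant_level s r = (SOME l. l < s \<and> r \<in> {real l / real s .. (real l + 1) / real s})"

definition zeta_pmf :: "nat \<Rightarrow> real ^ 'n \<Rightarrow> 'n \<Rightarrow> nat pmf" where
  "zeta_pmf s v i =
     (let r = \<bar>v $ i\<bar> / norm v; l = quant_level s r
      in map_pmf (\<lambda>b. if b then l + 1 else l) (bernoulli_pmf (r * real s - real l)))"

text \<open>The law of the stochastic quantization \<open>Q\<^sub>s(v)\<close>; the product measure makes the coordinates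
  independent.\<close>

definition quantize_pmf :: "nat \<Rightarrow> real ^ 'n \<Rightarrow> (real ^ 'n) pmf" where
  "quantize_pmf s v =
     (if v = 0 then return_pmf 0
      else map_pmf (\<lambda>z. \<chi> i. norm v * sgn (v $ i) * real (z i) / real s)
             (Pi_pmf UNIV 0 (zeta_pmf s v)))"

text \<open>The law of \<open>Q\<^sub>s(\<dots> Q\<^sub>s(Q\<^sub>s(w 1) + w 2) + \<dots> + w k)\<close>, with \<open>k\<close> applications of \<open>Q\<^sub>s\<close>.  Monadic
  bind draws fresh randomness for every application.\<close>

primrec cascade_pmf :: "nat \<Rightarrow> (nat \<Rightarrow> real ^ 'n) \<Rightarrow> nat \<Rightarrow> (real ^ 'n) pmf" where
  "cascade_pmf s w 0 = return_pmf 0"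
| "cascade_pmf s w (Suc k) =
     bind_pmf (cascade_pmf s w k) (\<lambda>x. quantize_pmf s (x + w (Suc k)))"

definition cascade_mean_pmf :: "nat \<Rightarrow> (nat \<Rightarrow> real ^ 'n) \<Rightarrow> nat \<Rightarrow> (real ^ 'n) pmf" where
  "cascade_mean_pmf s w M = map_pmf (\<lambda>x. (1 / real M) *\<^sub>R x) (cascade_pmf s w M)"

definition C1 :: "nat \<Rightarrow> nat \<Rightarrow> nat \<Rightarrow> real" where
  "C1 d s M =
     1 / real M * exp (real d / (4 * (real s)\<^sup>2))
     + 4 * (real s)\<^sup>2 / real d * (real d / (4 * (real s)\<^sup>2 * real M) + 1) ^ (M - 1)
     - (4 * (real s)\<^sup>2 / real d + 1)"

end

theory Submission
  imports Defs
begin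

text \<open>Each coordinate of \<open>Q\<^sub>s(v)\<close> is an unbiased Bernoulli variable on a grid of mesh \<open>\<parallel>v\<parallel>/s\<close>, hence has
  variance at most \<open>\<parallel>v\<parallel>\<^sup>2/(4s\<^sup>2)\<close>. With \<open>a = d/(4s\<^sup>2M)\<close> this gives
  \<open>E\<parallel>Q\<^sub>s(v) - c\<parallel>\<^sup>2 \<le> \<parallel>v - c\<parallel>\<^sup>2 + a\<parallel>v\<parallel>\<^sup>2\<close> for every \<open>c\<close>. Keeping \<open>c\<close> arbitrary makes the estimate inductive:
  after \<open>k\<close> steps \<open>E\<parallel>X\<^sub>k - c\<parallel>\<^sup>2 \<le> \<parallel>S\<^sub>k - c\<parallel>\<^sup>2 + b\<^sub>k\<close>, where \<open>S\<^sub>k\<close> is the exact partial sum and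
  \<open>b\<^sub>k = (1 + a) b\<^bsub>k-1\<^esub> + a\<parallel>S\<^sub>k\<parallel>\<^sup>2\<close>. Since \<open>\<parallel>S\<^sub>k\<parallel>\<^sup>2 \<le> k \<Sum>\<^sub>m \<parallel>w\<^sub>m\<parallel>\<^sup>2\<close>, the recursion is solved by
  \<open>cascade_factor\<close>, which \<open>e\<^sup>x \<ge> 1 + x\<close> and Bernoulli's inequality compare with \<open>C1\<close>.\<close>

lemma quant_level_exists:
  assumes "s \<ge> 1" "0 \<le> r" "r \<le> 1"
  shows "\<exists>l<s. r \<in> {real l / real s .. (real l + 1) / real s}"
proof (cases "r = 1")
  case True
  \<comment> \<open>At \<open>r = 1\<close> the floor of \<open>r * s\<close> would be the
    inadmissible level \<open>s\<close>; \<open>r\<close> is instead the right endpoint of the top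
    cell \<open>s - 1\<close>.\<close>
  then show ?thesis
    using assms by (intro exI[of _ "s - 1"]) (auto simp: field_simps of_nat_diff)
next
  case False
  define l where "l = nat \<lfloor>r * real s\<rfloor>"
  have l: "real l \<le> r * real s" "r * real s \<le> real l + 1"
    using assms by (auto simp: l_def)
  have "r * real s < real s"
    using assms False by simp
  with l have "l < s"
    by linarith
  with l assms show ?thesis
    by (intro exI[of _ l]) (auto simp: field_simps)
qed

lemma quant_level_bounds:
  assumes "s \<ge> 1" "0 \<le> r" "r \<le> 1"
  shows "real (quant_level s r) \<le> r * real s" "r * real s \<le> real (quant_level s r) + 1"
proof -
  have "quant_level s r < s \<and>
      r \<in> {real (quant_level s r) / real s .. (real (quant_level s r) + 1) / real s}"
    unfolding quant_level_def
    by (rule someI_ex) (use quant_level_exists[OF assms] in blast)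
  then show "real (quant_level s r) \<le> r * real s" "r * real s \<le> real (quant_level s r) + 1"
    using assms by (auto simp: field_simps)
qed

text \<open>Finite support, here and for the laws built from this one, makes every real function
  integrable.\<close>

lemma finite_set_zeta_pmf [simp]: "finite (set_pmf (zeta_pmf s v i))"
  by (simp add: zeta_pmf_def Let_def)

lemma finite_set_Pi_zeta_pmf [simp]:
  "finite (set_pmf (Pi_pmf (UNIV :: 'n::finite set) 0 (zeta_pmf s v)))"
  by (rule finite_subset[OF set_Pi_pmf_subset']) (auto intro: finite_PiE_dflt)

lemma finite_set_quantize_pmf [simp]: "finite (set_pmf (quantize_pmf s v))"
  by (simp add: quantize_pmf_def)

lemma finite_set_cascade_pmf [simp]: "finite (set_pmf (cascade_pmf s w k))"
  by (induction k) auto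

lemma zeta_pmf_expectation_diff_square_le:
  fixes v c :: "real ^ 'n"
  assumes s: "s \<ge> 1" and v: "v \<noteq> 0"
  shows "measure_pmf.expectation (zeta_pmf s v i)
           (\<lambda>z. (norm v * sgn (v $ i) * real z / real s - c $ i)\<^sup>2)
         \<le> (v $ i - c $ i)\<^sup>2 + (norm v)\<^sup>2 / (4 * (real s)\<^sup>2)"
proof -
  define r where "r = \<bar>v $ i\<bar> / norm v"
  define l where "l = quant_level s r"
  define p where "p = r * real s - real l"
  define g where "g = norm v * sgn (v $ i) / real s"
  have r: "0 \<le> r" "r \<le> 1"
    using v component_le_norm_cart[of v i] by (auto simp: r_def)
  have p: "0 \<le> p" "p \<le> 1"
    using quant_level_bounds[OF s r] by (auto simp: p_def l_def)
  have mean: "g * (real l + p) = v $ i"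
    using v s by (simp add: g_def p_def r_def mult.commute[of _ "sgn _"] sgn_mult_abs flip: mult.assoc)
  \<comment> \<open>Only an inequality: \<open>g\<close> vanishes when
    \<open>v $ i = 0\<close>.\<close>
  have g2: "g\<^sup>2 \<le> (norm v)\<^sup>2 / (real s)\<^sup>2"
    by (simp add: g_def power_mult_distrib power_divide sgn_if divide_right_mono)
  have p4: "p * (1 - p) \<le> 1 / 4"
    using zero_le_power2[of "p - 1/2"] by (simp add: power2_eq_square algebra_simps)
  have "measure_pmf.expectation (zeta_pmf s v i)
           (\<lambda>z. (norm v * sgn (v $ i) * real z / real s - c $ i)\<^sup>2)
      = p * (g * (real l + 1) - c $ i)\<^sup>2 + (1 - p) * (g * real l - c $ i)\<^sup>2"
    using p by (simp add: zeta_pmf_def Let_def g_def add.commute flip: r_def l_def p_def)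
  \<comment> \<open>Squared bias plus variance; by \<open>mean\<close> the bias is
    \<open>v $ i - c $ i\<close>.\<close>
  also have "\<dots> = (g * (real l + p) - c $ i)\<^sup>2 + g\<^sup>2 * (p * (1 - p))"
    by (simp add: power2_eq_square algebra_simps)
  also have "g\<^sup>2 * (p * (1 - p)) \<le> (norm v)\<^sup>2 / (real s)\<^sup>2 * (1 / 4)"
    using g2 p4 p by (intro mult_mono) auto
  finally show ?thesis
    by (simp add: mean mult.commute)
qed

lemma norm_square_vec: "(norm (x :: real ^ 'n))\<^sup>2 = (\<Sum>i\<in>UNIV. (x $ i)\<^sup>2)"
  unfolding power2_norm_eq_inner by (simp add: inner_vec_def power2_eq_square)

lemma quantize_pmf_expectation_diff_square_le:
  fixes v c :: "real ^ 'n"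
  assumes s: "s \<ge> 1"
  shows "measure_pmf.expectation (quantize_pmf s v) (\<lambda>x. (norm (x - c))\<^sup>2)
         \<le> (norm (v - c))\<^sup>2 + real CARD('n) / (4 * (real s)\<^sup>2) * (norm v)\<^sup>2"
proof (cases "v = 0")
  case True
  then show ?thesis by (simp add: quantize_pmf_def)
next
  case False
  let ?P = "Pi_pmf (UNIV :: 'n set) 0 (zeta_pmf s v)"
  let ?h = "\<lambda>i z. (norm v * sgn (v $ i) * real z / real s - c $ i)\<^sup>2"
  have "measure_pmf.expectation (quantize_pmf s v) (\<lambda>x. (norm (x - c))\<^sup>2)
      = measure_pmf.expectation ?P (\<lambda>z. \<Sum>i\<in>UNIV. ?h i (z i))"
    using False by (simp add: quantize_pmf_def norm_square_vec)
  also have "\<dots> = (\<Sum>i\<in>UNIV. measure_pmf.expectation ?P (\<lambda>z. ?h i (z i)))"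
    by (intro Bochner_Integration.integral_sum integrable_measure_pmf_finite) simp
  also have "\<dots> = (\<Sum>i\<in>UNIV. measure_pmf.expectation (map_pmf (\<lambda>z. z i) ?P) (?h i))"
    by simp
  also have "\<dots> = (\<Sum>i\<in>UNIV. measure_pmf.expectation (zeta_pmf s v i) (?h i))"
    by (subst Pi_pmf_component) auto
  also have "\<dots> \<le> (\<Sum>i\<in>UNIV. (v $ i - c $ i)\<^sup>2 + (norm v)\<^sup>2 / (4 * (real s)\<^sup>2))"
    by (intro sum_mono zeta_pmf_expectation_diff_square_le[OF s False])
  finally show ?thesis
    by (simp add: sum.distrib norm_square_vec)
qed

text \<open>For \<open>a > 0\<close>, the closed form of the sum of
  \<open>a * j * (1 + a) ^ (k - j)\<close> over \<open>j = 1..k\<close>.\<close>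

definition cascade_factor :: "real \<Rightarrow> nat \<Rightarrow> real" where
  "cascade_factor a k = (1 + a) / a * ((1 + a) ^ k - 1) - real k"

lemma cascade_factor_0 [simp]: "cascade_factor a 0 = 0"
  by (simp add: cascade_factor_def)

lemma cascade_factor_Suc:
  assumes "a > 0"
  shows "cascade_factor a (Suc k) = (1 + a) * cascade_factor a k + a * real (Suc k)"
  using assms by (simp add: cascade_factor_def field_simps)

lemma cascade_factor_nonneg: "a > 0 \<Longrightarrow> cascade_factor a k \<ge> 0"
  by (induction k) (auto simp: cascade_factor_Suc)

text \<open>Triangle inequality, then Cauchy-Schwarz against the constant 1.\<close>

lemma norm_sum_square_le:
  fixes f :: "'a \<Rightarrow> 'b::real_normed_vector"
  shows "(norm (\<Sum>i\<in>A. f i))\<^sup>2 \<le> real (card A) * (\<Sum>i\<in>A. (norm (f i))\<^sup>2)"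
proof -
  have "(norm (\<Sum>i\<in>A. f i))\<^sup>2 \<le> (\<Sum>i\<in>A. norm (f i))\<^sup>2"
    by (intro power_mono norm_sum) auto
  also have "\<dots> \<le> real (card A) * (\<Sum>i\<in>A. (norm (f i))\<^sup>2)"
    using sum_squared_le_sum_of_squares[of "\<lambda>i. norm (f i)" A]
    by (simp add: mult.commute)
  finally show ?thesis .
qed

lemma cascade_pmf_expectation_diff_square_le:
  fixes c :: "real ^ 'n" and w :: "nat \<Rightarrow> real ^ 'n"
  assumes s: "s \<ge> 1" and a: "a = real CARD('n) / (4 * (real s)\<^sup>2)"
  shows "measure_pmf.expectation (cascade_pmf s w k) (\<lambda>x. (norm (x - c))\<^sup>2)
         \<le> (norm ((\<Sum>m = 1..k. w m) - c))\<^sup>2 + cascade_factor a k * (\<Sum>m = 1..k. (norm (w m))\<^sup>2)"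
proof (induction k arbitrary: c)
  case 0
  then show ?case by simp
next
  case (Suc k)
  have a0: "a > 0"
    using s by (simp add: a)
  let ?X = "cascade_pmf s w k" and ?v = "w (Suc k)"
  define S where "S = (\<Sum>m = 1..k. w m)"
  define W where "W = (\<Sum>m = 1..k. (norm (w m))\<^sup>2)"
  define W' where "W' = (\<Sum>m = 1..Suc k. (norm (w m))\<^sup>2)"
  have W: "W \<le> W'"
    by (simp add: W_def W'_def)
  have S: "(norm (S + ?v))\<^sup>2 \<le> real (Suc k) * W'"
    using norm_sum_square_le[of w "{1..Suc k}"] by (simp add: S_def W'_def)
  have int: "integrable ?X f" for f :: "_ \<Rightarrow> real"
    by (intro integrable_measure_pmf_finite) simp
  have "measure_pmf.expectation (cascade_pmf s w (Suc k)) (\<lambda>x. (norm (x - c))\<^sup>2)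
      = measure_pmf.expectation ?X
          (\<lambda>x. measure_pmf.expectation (quantize_pmf s (x + ?v)) (\<lambda>y. (norm (y - c))\<^sup>2))"
    by (simp add: pmf_expectation_bind[of "set_pmf ?X"] integral_measure_pmf[of "set_pmf ?X"])
  \<comment> \<open>The quantization error \<open>a * (norm (x + ?v))\<^sup>2\<close> is again a
    squared distance, to the centre \<open>- ?v\<close>. The induction hypothesis thus applies
    twice, with centres \<open>c - ?v\<close> and \<open>- ?v\<close>.\<close>
  also have "\<dots> \<le> measure_pmf.expectation ?X
          (\<lambda>x. (norm (x - (c - ?v)))\<^sup>2 + a * (norm (x - (- ?v)))\<^sup>2)"
    using quantize_pmf_expectation_diff_square_le[OF s, of "_ + ?v" c]
    by (intro integral_mono int) (simp add: a algebra_simps)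
  also have "\<dots> = measure_pmf.expectation ?X (\<lambda>x. (norm (x - (c - ?v)))\<^sup>2)
      + a * measure_pmf.expectation ?X (\<lambda>x. (norm (x - (- ?v)))\<^sup>2)"
    by (subst Bochner_Integration.integral_add[OF int int]) simp
  also have "\<dots> \<le> ((norm (S - (c - ?v)))\<^sup>2 + cascade_factor a k * W)
      + a * ((norm (S - (- ?v)))\<^sup>2 + cascade_factor a k * W)"
    using a0 unfolding S_def W_def by (intro add_mono mult_left_mono Suc) auto
  also have "\<dots> = (norm (S + ?v - c))\<^sup>2 + ((1 + a) * cascade_factor a k) * W
      + a * (norm (S + ?v))\<^sup>2"
    by (simp add: algebra_simps)
  also have "\<dots> \<le> (norm (S + ?v - c))\<^sup>2 + ((1 + a) * cascade_factor a k) * W'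
      + a * (real (Suc k) * W')"
    using a0 W S cascade_factor_nonneg[OF a0, of k] by (intro add_mono mult_left_mono) auto
  also have "\<dots> = (norm (S + ?v - c))\<^sup>2 + cascade_factor a (Suc k) * W'"
    by (simp add: cascade_factor_Suc[OF a0] algebra_simps)
  finally show ?case
    by (simp add: S_def W'_def)
qed

lemma cascade_factor_le:
  assumes a: "a > 0" and M: "M \<ge> 1"
  shows "cascade_factor a M \<le> 2 * (exp (a * real M) + ((1 + a) ^ (M - 1) - 1) / a - real M)"
proof -
  obtain k where k: "M = Suc k"
    using M by (cases M) auto
  define q where "q = (1 + a) ^ k"
  have "(1 + a) ^ M \<le> exp a ^ M"
    using a by (intro power_mono) auto
  then have 1: "(1 + a) * q \<le> exp (a * real M)"
    by (simp only: exp_of_nat2_mult) (simp add: k q_def)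
  have "1 + real k * a \<le> q"
    unfolding q_def using a by (intro Bernoulli_inequality) auto
  then have 2: "real k \<le> (q - 1) / a"
    using a by (simp add: field_simps)
  have 3: "q \<le> (1 + a) * q"
    using a by (simp add: q_def algebra_simps)
  have "cascade_factor a M = (1 + a) * q + q - 1 + (q - 1) / a - real M"
    using a by (simp add: cascade_factor_def k q_def field_simps)
  \<comment> \<open>Since \<open>M = k + 1\<close>, right minus left is the sum of
    \<open>exp (a * M) - (1 + a) * q\<close>, \<open>exp (a * M) - q\<close> and
    \<open>(q - 1) / a - k\<close>, all nonnegative.\<close>
  also have "\<dots> \<le> 2 * (exp (a * real M) + (q - 1) / a - real M)"
    using add_mono[OF order_trans[OF 3 1] 2] 1 unfolding k of_nat_Suc distrib_left right_diff_distrib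
    by (smt (verit))
  finally show ?thesis
    by (simp add: k q_def)
qed

theorem lemma1:
  fixes d M s i :: nat
    and w :: "nat \<Rightarrow> nat \<Rightarrow> real ^ 'n"
  assumes "M \<ge> 1" and "d > 0" and "M dvd d" and "s \<ge> 1"
    and "CARD('n) = d div M"
    and "i \<in> {1..M}"
  shows "measure_pmf.expectation (cascade_mean_pmf s (\<lambda>m. w m i) M)
           (\<lambda>X. (norm (X - (1 / real M) *\<^sub>R (\<Sum>m = 1..M. w m i)))\<^sup>2)
         \<le> 2 * C1 d s M / real M * (\<Sum>m = 1..M. (norm (w m i))\<^sup>2)"
proof -
  define a where "a = real CARD('n) / (4 * (real s)\<^sup>2)"
  let ?S = "\<Sum>m = 1..M. w m i" and ?W = "\<Sum>m = 1..M. (norm (w m i))\<^sup>2"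
  have M: "real M > 0" and a0: "a > 0"
    using assms by (auto simp: a_def)
  have "real d = real M * real CARD('n)"
    using assms by (simp flip: of_nat_mult)
  then have d: "real d / (4 * (real s)\<^sup>2) = a * real M"
      "real d / (4 * (real s)\<^sup>2 * real M) = a" "4 * (real s)\<^sup>2 / real d = 1 / (a * real M)"
    using M \<open>s \<ge> 1\<close> by (auto simp: a_def field_simps)
  \<comment> \<open>This is exactly half of the bound in \<open>cascade_factor_le\<close>.\<close>
  have C1: "C1 d s M * real M = exp (a * real M) + ((1 + a) ^ (M - 1) - 1) / a - real M"
    unfolding C1_def d using M a0 by (simp add: field_simps)
  have "measure_pmf.expectation (cascade_mean_pmf s (\<lambda>m. w m i) M)
           (\<lambda>X. (norm (X - (1 / real M) *\<^sub>R ?S))\<^sup>2)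
      = measure_pmf.expectation (cascade_pmf s (\<lambda>m. w m i) M) (\<lambda>x. (norm (x - ?S))\<^sup>2 / (real M)\<^sup>2)"
    using M by (simp add: cascade_mean_pmf_def power_divide flip: scaleR_diff_right)
  \<comment> \<open>Choosing the exact sum \<open>?S\<close> as centre makes the deterministic
    distance vanish, leaving only the accumulated variance.\<close>
  also have "\<dots> \<le> cascade_factor a M * ?W / (real M)\<^sup>2"
    using cascade_pmf_expectation_diff_square_le[OF \<open>s \<ge> 1\<close> a_def, of "\<lambda>m. w m i" M ?S]
    by (simp add: divide_right_mono)
  also have "\<dots> \<le> 2 * (C1 d s M * real M) * ?W / (real M)\<^sup>2"
    unfolding C1 by (intro divide_right_mono mult_right_mono cascade_factor_le a0 \<open>M \<ge> 1\<close> sum_nonneg) auto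
  also have "\<dots> = 2 * C1 d s M / real M * ?W"
    using M by (simp add: power2_eq_square)
  finally show ?thesis .
qed

end
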